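(* There exist functions $W(z)\not\equiv 0$ and $V(z)$, independent of $n$ and related to the weight by $W(z)w'(z)=2V(z)w(z)$, and coefficient functions $\Theta_n(z),\Omega_n(z),\Theta^*_n(z),\Omega^*_n(z)$ ($n\ge 0$) such that the derivatives ($'=d/dz$) of the bi-orthogonal polynomials and associated functions are, for all $n\ge0$, $$W(z)\phi'_n(z)=\Theta_n(z)\phi_{n+1}(z)-(\Omega_n(z)+V(z))\phi_n(z),$$ $$W(z)\phi^{*\prime}_n(z)=-\Theta^*_n(z)\phi^*_{n+1}(z)+(\Omega^*_n(z)-V(z))\phi^*_n(z),$$ $$W(z)\epsilon'_n(z)=\Theta_n(z)\epsilon_{n+1}(z)-(\Omega_n(z)-V(z))\epsilon_n(z),$$ $$W(z)\epsilon^{*\prime}_n(z)=-\Theta^*_n(z)\epsilon^*_{n+1}(z)+(\Omega^*_n(z)+V(z))\epsilon^*_n(z).$$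
   Context: Let $\mathbb T=\{\zeta\in\mathbb C:|\zeta|=1\}$, $\zeta=e^{i\theta}$, $\theta\in(-\pi,\pi]$. The weight $w$ is a complex (not necessarily real or positive) function, analytic in a cut complex plane, with $z^jw,z^jw'\in L^1(\mathbb T)$ for all $j\in\mathbb Z$ and with expansion $w(z)=\sum_{k\in\mathbb Z}w_kz^k$, $w_k=\int_{\mathbb T}\frac{d\zeta}{2\pi i\zeta}w(\zeta)\zeta^{-k}$, converging in an annulus containing $\mathbb T$. Assume $\det[w_{j-k}]_{0\le j,k\le n-1}\ne0$ for all $n\ge1$. The bi-orthonormal polynomials are $\phi_n(z)=\kappa_nz^n+\dots+\phi_n(0)$ and $\bar\phi_n(z)=\kappa_nz^n+\dots+\bar\phi_n(0)$, of degree $n$ with the same leading coefficient $\kappa_n\ne0$, satisfying $\int_{\mathbb T}\frac{d\zeta}{2\pi i\zeta}w(\zeta)\phi_m(\zeta)\bar\phi_n(\bar\zeta)=\delta_{m,n}$ with $\bar\zeta=\zeta^{-1}$ on $\mathbb T$; the bar on $\bar\phi_n$ is notation and does not denote complex conjugation. The reciprocal polynomial is $\phi^*_n(z)=z^n\bar\phi_n(1/z)$. It is assumed that $\phi_n(0)\neq0$ and $\bar\phi_n(0)\ne0$ for all $n$. With $F(z)=\int_{\mathbb T}\frac{d\zeta}{2\pi i\zeta}\frac{\zeta+z}{\zeta-z}w(\zeta)$, the associated functions, defined for $z\notin\mathbb T$, are $\epsilon_n(z)=\int_{\mathbb T}\frac{d\zeta}{2\pi i\zeta}\frac{\zeta+z}{\zeta-z}w(\zeta)\phi_n(\zeta)$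 and $\epsilon^*_n(z)=-z^n\int_{\mathbb T}\frac{d\zeta}{2\pi i\zeta}\frac{\zeta+z}{\zeta-z}w(\zeta)\bar\phi_n(\bar\zeta)$ for $n\ge1$, and $\epsilon_0=1/\kappa_0+\kappa_0F$, $\epsilon^*_0=1/\kappa_0-\kappa_0F$. The relations are understood for $z\notin\mathbb T$ off the cuts of $w$. *)

theory Defs
  imports
    "HOL-Complex_Analysis.Complex_Analysis"
    "HOL-Computational_Algebra.Polynomial"
    "Jordan_Normal_Form.Determinant"
begin

(* The complement of a closed set of cuts that has empty interior and does not
   disconnect the plane. *)
definition cut_plane :: "complex set \<Rightarrow> bool" where
  "cut_plane D \<longleftrightarrow> open D \<and> connected D \<and> closure D = UNIV"

(* Integration over the unit circle against d\<zeta> / (2 \<pi> i \<zeta>). *)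
definition circle_mean :: "(complex \<Rightarrow> complex) \<Rightarrow> complex" where
  "circle_mean f = contour_integral (circlepath 0 1) (\<lambda>\<zeta>. f \<zeta> / (2 * of_real pi * \<i> * \<zeta>))"

definition circle_L1 :: "(complex \<Rightarrow> complex) \<Rightarrow> bool" where
  "circle_L1 f \<longleftrightarrow> (\<lambda>\<theta>. f (cis \<theta>)) absolutely_integrable_on {-pi..pi}"

definition fourier_coeff :: "(complex \<Rightarrow> complex) \<Rightarrow> int \<Rightarrow> complex" where
  "fourier_coeff w k = circle_mean (\<lambda>\<zeta>. w \<zeta> * \<zeta> powi (- k))"

definition toeplitz_det :: "(complex \<Rightarrow> complex) \<Rightarrow> nat \<Rightarrow> complex" where
  "toeplitz_det w n =
     Determinant.det (Matrix.mat n n (\<lambda>(j, k). fourier_coeff w (int j - int k)))"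

(* \<phi>b stands for the sequence written with a bar on paper; \<zeta>-bar is 1/\<zeta> on the circle. *)
definition biorthonormal ::
  "(complex \<Rightarrow> complex) \<Rightarrow> (nat \<Rightarrow> complex) \<Rightarrow> (nat \<Rightarrow> complex poly) \<Rightarrow> (nat \<Rightarrow> complex poly) \<Rightarrow> bool"
where
  "biorthonormal w \<kappa> \<phi> \<phi>b \<longleftrightarrow>
     (\<forall>n. \<kappa> n \<noteq> 0 \<and>
          degree (\<phi> n) = n \<and> lead_coeff (\<phi> n) = \<kappa> n \<and>
          degree (\<phi>b n) = n \<and> lead_coeff (\<phi>b n) = \<kappa> n) \<and>
     (\<forall>m n. circle_mean (\<lambda>\<zeta>. w \<zeta> * poly (\<phi> m) \<zeta> * poly (\<phi>b n) (1 / \<zeta>)) =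
            (if m = n then 1 else 0))"

(* As \<phi>b n has degree n, reflect_poly is z^n \<phi>b_n(1/z), extended to z = 0. *)
definition recip_poly :: "(nat \<Rightarrow> complex poly) \<Rightarrow> nat \<Rightarrow> complex poly" where
  "recip_poly \<phi>b n = reflect_poly (\<phi>b n)"

definition caratheodory_fun :: "(complex \<Rightarrow> complex) \<Rightarrow> complex \<Rightarrow> complex" where
  "caratheodory_fun w z = circle_mean (\<lambda>\<zeta>. (\<zeta> + z) / (\<zeta> - z) * w \<zeta>)"

definition assoc_fun ::
  "(complex \<Rightarrow> complex) \<Rightarrow> (nat \<Rightarrow> complex) \<Rightarrow> (nat \<Rightarrow> complex poly) \<Rightarrow> nat \<Rightarrow> complex \<Rightarrow> complex"
where
  "assoc_fun w \<kappa> \<phi> n z =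
     (if n = 0 then 1 / \<kappa> 0 + \<kappa> 0 * caratheodory_fun w z
      else circle_mean (\<lambda>\<zeta>. (\<zeta> + z) / (\<zeta> - z) * w \<zeta> * poly (\<phi> n) \<zeta>))"

definition assoc_fun_star ::
  "(complex \<Rightarrow> complex) \<Rightarrow> (nat \<Rightarrow> complex) \<Rightarrow> (nat \<Rightarrow> complex poly) \<Rightarrow> nat \<Rightarrow> complex \<Rightarrow> complex"
where
  "assoc_fun_star w \<kappa> \<phi>b n z =
     (if n = 0 then 1 / \<kappa> 0 - \<kappa> 0 * caratheodory_fun w z
      else - (z ^ n) * circle_mean (\<lambda>\<zeta>. (\<zeta> + z) / (\<zeta> - z) * w \<zeta> * poly (\<phi>b n) (1 / \<zeta>)))"

end

theory Submission
  imports Defs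
begin

text \<open>
  Take \<open>W = z w\<close> and \<open>V = z w'/2\<close>. For fixed \<open>n\<close> and \<open>z\<close> the equations for \<open>\<phi>\<^sub>n'\<close> and \<open>\<epsilon>\<^sub>n'\<close> are a
  linear system for \<open>\<Theta>\<^sub>n(z)\<close> and \<open>\<Omega>\<^sub>n(z)\<close>, whose determinant is up to sign the Casoratian
  \<open>\<phi>\<^sub>n\<^sub>+\<^sub>1 \<epsilon>\<^sub>n - \<phi>\<^sub>n \<epsilon>\<^sub>n\<^sub>+\<^sub>1\<close>. The system is solvable because this is
  \<open>2 (\<phi>\<^sub>n\<^sub>+\<^sub>1(0)/\<kappa>\<^sub>n) z\<^sup>n\<close>, with a nonzero constant. In the same way the starred pair has the
  Casoratian \<open>2 (c\<^sub>n\<^sub>+\<^sub>1/\<kappa>\<^sub>n) z\<^sup>n\<^sup>+\<^sup>1\<close>, where \<open>c\<^sub>n\<^sub>+\<^sub>1\<close> is the constant coefficient of the barred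
  polynomial of degree \<open>n + 1\<close>.

  The zero of the Casoratian at \<open>z = 0\<close> matters when the origin lies in the domain. It is harmless
  since orthogonality allows the same power of \<open>z\<close> to be factored out of the associated functions:
  everywhere off the circle, \<open>\<epsilon>\<^sub>n = z\<^sup>n a\<^sub>n\<close> where \<open>a\<^sub>n\<close> is the Cauchy transform of
  \<open>2 \<zeta>\<^sup>1\<^sup>-\<^sup>n w \<phi>\<^sub>n\<close>, and the starred function is likewise \<open>z\<^sup>n\<^sup>+\<^sup>1\<close> times a Cauchy transform
  (\<open>assoc_fun_eq_cauchy_transform\<close>, \<open>assoc_fun_star_eq_cauchy_transform\<close>). Differentiating
  \<open>z\<^sup>n a\<^sub>n\<close> costs one power of \<open>z\<close>, and the factor \<open>z\<close> of \<open>W\<close> restores it. Dividing out the power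
  gives a system with constant determinant, so Cramer's rule yields holomorphic coefficients
  (\<open>cramer_coefficients\<close>).

  What remains is that the Casoratians in terms of the Cauchy transforms are constant. A Cauchy
  transform commutes with multiplication by a polynomial, as long as the moments of the density that
  enter the division by \<open>\<zeta> - z\<close> vanish (\<open>poly_times_cauchy_transform\<close>). Orthogonality supplies
  exactly as many vanishing moments as needed to move all polynomials inside, except for the leading
  term of one of them. Inside, the two products cancel identically, and the exceptional term is the
  constant (\<open>casoratian_cauchy_transform\<close>).
\<close>

section \<open>The mean over the unit circle\<close>

lemma circle_mean_integrable:
  assumes "continuous_on (sphere 0 1) f"
  shows "(\<lambda>\<zeta>. f \<zeta> / (2 * of_real pi * \<i> * \<zeta>)) contour_integrable_on circlepath 0 1"
  by (rule contour_integrable_continuous_circlepath)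
     (use assms in \<open>auto intro!: continuous_intros\<close>)

lemma circle_mean_cong:
  assumes "\<And>\<zeta>. norm \<zeta> = 1 \<Longrightarrow> f \<zeta> = g \<zeta>"
  shows "circle_mean f = circle_mean g"
  unfolding circle_mean_def by (rule contour_integral_eq) (use assms in auto)

lemma circle_mean_add:
  assumes "continuous_on (sphere 0 1) f" "continuous_on (sphere 0 1) g"
  shows "circle_mean (\<lambda>\<zeta>. f \<zeta> + g \<zeta>) = circle_mean f + circle_mean g"
  unfolding circle_mean_def add_divide_distrib
  by (intro contour_integral_add circle_mean_integrable assms)

lemma circle_mean_cmult:
  assumes "continuous_on (sphere 0 1) f"
  shows "circle_mean (\<lambda>\<zeta>. c * f \<zeta>) = c * circle_mean f"
  unfolding circle_mean_def times_divide_eq_right [symmetric]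
  by (intro contour_integral_lmul circle_mean_integrable assms)

lemma circle_mean_diff:
  assumes "continuous_on (sphere 0 1) f" "continuous_on (sphere 0 1) g"
  shows "circle_mean (\<lambda>\<zeta>. f \<zeta> - g \<zeta>) = circle_mean f - circle_mean g"
  unfolding circle_mean_def diff_divide_distrib
  by (intro contour_integral_diff circle_mean_integrable assms)

lemma circle_mean_sum:
  assumes "finite I" "\<And>i. i \<in> I \<Longrightarrow> continuous_on (sphere 0 1) (f i)"
  shows "circle_mean (\<lambda>\<zeta>. \<Sum>i\<in>I. f i \<zeta>) = (\<Sum>i\<in>I. circle_mean (f i))"
  unfolding circle_mean_def sum_divide_distrib
  by (intro contour_integral_sum circle_mean_integrable assms)

section \<open>The Cauchy transform of a density on the circle\<close>

definition cauchy_transform :: "(complex \<Rightarrow> complex) \<Rightarrow> complex \<Rightarrow> complex" where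
  "cauchy_transform g z = circle_mean (\<lambda>\<zeta>. g \<zeta> / (\<zeta> - z))"

lemma cauchy_transform_cong:
  assumes "\<And>\<zeta>. norm \<zeta> = 1 \<Longrightarrow> f \<zeta> = g \<zeta>"
  shows "cauchy_transform f z = cauchy_transform g z"
  unfolding cauchy_transform_def by (rule circle_mean_cong) (simp add: assms)

lemma holomorphic_cauchy_transform:
  assumes g: "continuous_on (sphere 0 1) g" and S: "open S" "S \<inter> sphere 0 1 = {}"
  shows "cauchy_transform g holomorphic_on S"
proof -
  define h where "h = (\<lambda>u. g u / (2 * of_real pi * \<i> * u))"
  have h: "continuous_on (path_image (circlepath 0 1)) h"
    unfolding h_def using g by (auto intro!: continuous_intros)
  have int: "((\<lambda>u. h u / (u - z) ^ 1) has_contour_integral cauchy_transform g z) (circlepath 0 1)"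
    if "z \<in> UNIV - path_image (circlepath 0 1)" for z
  proof -
    have "(\<lambda>u. h u / (u - z) ^ 1) contour_integrable_on circlepath 0 1"
      by (rule contour_integrable_continuous_circlepath)
         (use h that in \<open>auto intro!: continuous_intros\<close>)
    moreover have "contour_integral (circlepath 0 1) (\<lambda>u. h u / (u - z) ^ 1) = cauchy_transform g z"
      unfolding cauchy_transform_def circle_mean_def h_def
      by (rule contour_integral_eq) (simp add: field_simps)
    ultimately show ?thesis
      by (metis has_contour_integral_integral)
  qed
  have "cauchy_transform g field_differentiable at z" if "z \<in> S" for z
  proof -
    have "z \<in> UNIV - path_image (circlepath 0 1)"
      using that S by auto
    from Cauchy_next_derivative(2) [OF h _ int _ open_UNIV valid_path_circlepath this, of "2 * pi"]
    show ?thesis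
      unfolding field_differentiable_def
      by (auto simp: vector_derivative_circlepath norm_mult)
  qed
  then show ?thesis
    using S by (simp add: holomorphic_on_open field_differentiable_def)
qed

text \<open>
  Dividing \<^term>\<open>p\<close> by \<open>\<zeta> - z\<close> leaves the remainder \<open>p(z)\<close>, and the mean of the quotient against
  \<^term>\<open>g\<close> sees only the moments of \<^term>\<open>g\<close> of order up to \<^term>\<open>N\<close>. So a polynomial can be moved
  through the Cauchy transform, up to a constant that comes from its top coefficient.
\<close>

lemma poly_times_cauchy_transform:
  assumes g: "continuous_on (sphere 0 1) g" and z: "norm z \<noteq> 1"
    and p: "degree p \<le> Suc N"
    and mom: "\<And>i. i < N \<Longrightarrow> circle_mean (\<lambda>\<zeta>. \<zeta> ^ i * g \<zeta>) = 0"
  shows "poly p z * cauchy_transform g z =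
    cauchy_transform (\<lambda>\<zeta>. poly p \<zeta> * g \<zeta>) z - coeff p (Suc N) * circle_mean (\<lambda>\<zeta>. \<zeta> ^ N * g \<zeta>)"
proof -
  define q where "q = synthetic_div p z"
  have pq: "p = [:- z, 1:] * q + [:poly p z:]"
    unfolding q_def by (simp only: synthetic_div_correct')
  have degq: "degree q \<le> N"
    using p unfolding q_def degree_synthetic_div by simp
  have "coeff p (Suc N) = coeff ([:- z, 1:] * q + [:poly p z:]) (Suc N)"
    using pq by simp
  also have "\<dots> = coeff q N"
    using degq by (simp add: coeff_eq_0 less_Suc_eq_le)
  finally have top: "coeff p (Suc N) = coeff q N" .
  have ne: "\<zeta> - z \<noteq> 0" if "norm \<zeta> = 1" for \<zeta>
    using that z by auto
  have c1: "continuous_on (sphere 0 1) (\<lambda>\<zeta>. g \<zeta> / (\<zeta> - z))"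
    and c2: "continuous_on (sphere 0 1) (\<lambda>\<zeta>. poly p \<zeta> * g \<zeta> / (\<zeta> - z))"
    using ne by (auto intro!: continuous_intros g)
  have "cauchy_transform (\<lambda>\<zeta>. poly p \<zeta> * g \<zeta>) z - poly p z * cauchy_transform g z
      = circle_mean (\<lambda>\<zeta>. poly p \<zeta> * g \<zeta> / (\<zeta> - z) - poly p z * (g \<zeta> / (\<zeta> - z)))"
    unfolding cauchy_transform_def
    by (subst circle_mean_diff, rule c2, intro continuous_intros c1, subst circle_mean_cmult[OF c1])
       simp
  also have "\<dots> = circle_mean (\<lambda>\<zeta>. \<Sum>i\<le>N. coeff q i * (\<zeta> ^ i * g \<zeta>))"
  proof (rule circle_mean_cong)
    fix \<zeta> :: complex assume "norm \<zeta> = 1"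
    have "poly p \<zeta> = (\<zeta> - z) * poly q \<zeta> + poly p z"
      by (subst pq) (simp add: algebra_simps)
    then have "poly p \<zeta> * g \<zeta> / (\<zeta> - z) - poly p z * (g \<zeta> / (\<zeta> - z)) = poly q \<zeta> * g \<zeta>"
      using ne[OF \<open>norm \<zeta> = 1\<close>] by (simp add: distrib_right add_divide_distrib)
    also have "poly q \<zeta> = (\<Sum>i\<le>N. coeff q i * \<zeta> ^ i)"
      unfolding poly_altdef using degq by (intro sum.mono_neutral_left) (auto simp: coeff_eq_0)
    finally show "poly p \<zeta> * g \<zeta> / (\<zeta> - z) - poly p z * (g \<zeta> / (\<zeta> - z)) =
        (\<Sum>i\<le>N. coeff q i * (\<zeta> ^ i * g \<zeta>))"
      by (simp add: sum_distrib_right mult.assoc)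
  qed
  also have "\<dots> = (\<Sum>i\<le>N. coeff q i * circle_mean (\<lambda>\<zeta>. \<zeta> ^ i * g \<zeta>))"
    by (subst circle_mean_sum) (auto intro!: continuous_intros g circle_mean_cmult sum.cong)
  also have "\<dots> = (\<Sum>i\<in>{N}. coeff q i * circle_mean (\<lambda>\<zeta>. \<zeta> ^ i * g \<zeta>))"
    by (rule sum.mono_neutral_right) (auto simp: mom)
  finally show ?thesis
    using top by (simp add: algebra_simps)
qed

text \<open>
  Both Casoratians of the problem are of this form. Moving \<open>p\<^sub>1\<close> and \<open>z p\<^sub>0\<close> inside makes the two
  densities equal, and only the boundary term of \<open>p\<^sub>1\<close> survives.
\<close>

lemma casoratian_cauchy_transform:
  assumes g0: "continuous_on (sphere 0 1) g0" and g1: "continuous_on (sphere 0 1) g1"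
    and z: "norm z \<noteq> 1"
    and p0: "degree p0 \<le> n" and p1: "degree p1 \<le> Suc n"
    and mom0: "\<And>i. i < n \<Longrightarrow> circle_mean (\<lambda>\<zeta>. \<zeta> ^ i * g0 \<zeta>) = 0"
    and mom1: "\<And>i. i < Suc n \<Longrightarrow> circle_mean (\<lambda>\<zeta>. \<zeta> ^ i * g1 \<zeta>) = 0"
    and eq: "\<And>\<zeta>. norm \<zeta> = 1 \<Longrightarrow> poly p1 \<zeta> * g0 \<zeta> = \<zeta> * poly p0 \<zeta> * g1 \<zeta>"
  shows "poly p1 z * cauchy_transform g0 z - z * poly p0 z * cauchy_transform g1 z
           = - coeff p1 (Suc n) * circle_mean (\<lambda>\<zeta>. \<zeta> ^ n * g0 \<zeta>)"
proof -
  have "degree (pCons 0 p0) \<le> Suc (Suc n)" "coeff (pCons 0 p0) (Suc (Suc n)) = 0"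
    using p0 by (auto simp: degree_pCons_eq_if coeff_eq_0)
  then have "poly (pCons 0 p0) z * cauchy_transform g1 z =
      cauchy_transform (\<lambda>\<zeta>. poly (pCons 0 p0) \<zeta> * g1 \<zeta>) z"
    using poly_times_cauchy_transform[OF g1 z _ mom1, of "pCons 0 p0"] by simp
  moreover have "cauchy_transform (\<lambda>\<zeta>. poly (pCons 0 p0) \<zeta> * g1 \<zeta>) z
      = cauchy_transform (\<lambda>\<zeta>. poly p1 \<zeta> * g0 \<zeta>) z"
    by (rule cauchy_transform_cong) (simp add: eq)
  ultimately show ?thesis
    using poly_times_cauchy_transform[OF g0 z p1 mom0] by simp
qed

section \<open>Moments of bi-orthonormal polynomials\<close>

text \<open>
  By induction on the degree, \<^term>\<open>L\<close> kills everything of degree below \<^term>\<open>n\<close>, because a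
  multiple of the basis element of the same degree removes the leading term. At degree \<^term>\<open>n\<close>
  the same step leaves the leading coefficient. Here \<^term>\<open>B\<close> is one of the two families of
  polynomials and \<^term>\<open>L\<close> the pairing with the \<^term>\<open>n\<close>-th member of the other.
\<close>

lemma functional_of_dual_basis:
  fixes L :: "complex poly \<Rightarrow> complex" and B :: "nat \<Rightarrow> complex poly"
  assumes add: "\<And>p q. L (p + q) = L p + L q"
    and smult: "\<And>c p. L (Polynomial.smult c p) = c * L p"
    and deg: "\<And>m. degree (B m) = m" and lc: "\<And>m. lead_coeff (B m) \<noteq> 0"
    and dual: "\<And>m. m \<le> n \<Longrightarrow> L (B m) = (if m = n then 1 else 0)"
    and q: "degree q \<le> n"
  shows "L q = coeff q n / lead_coeff (B n)"
proof -
  have "L q = (if d = n then coeff q n / lead_coeff (B n) else 0)" if "degree q \<le> d" "d \<le> n" for d q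
    using that
  proof (induction d arbitrary: q)
    case 0
    have "coeff (B 0) 0 \<noteq> 0"
      using lc[of 0] deg[of 0] by simp
    moreover obtain b where "B 0 = [:b:]"
      using deg[of 0] degree_eq_zeroE by blast
    moreover obtain a where "q = [:a:]"
      using 0 degree_eq_zeroE by blast
    ultimately have "q = Polynomial.smult (coeff q 0 / coeff (B 0) 0) (B 0)"
      by simp
    then have "L q = coeff q 0 / coeff (B 0) 0 * L (B 0)"
      by (metis smult)
    then show ?case
      using dual[of 0] deg[of 0] by auto
  next
    case (Suc d)
    define c where "c = coeff q (Suc d) / lead_coeff (B (Suc d))"
    define r where "r = q - Polynomial.smult c (B (Suc d))"
    have "degree r \<le> Suc d"
      unfolding r_def using Suc.prems deg[of "Suc d"]
      by (intro degree_diff_le) (auto intro: order.trans[OF degree_smult_le])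
    moreover have "coeff r (Suc d) = 0"
      unfolding r_def c_def using lc[of "Suc d"] deg[of "Suc d"] by simp
    ultimately have "degree r \<le> d"
      by (metis degree_0 leading_coeff_0_iff le_SucE zero_le)
    then have "L r = 0"
      using Suc.IH[of r] Suc.prems by simp
    moreover have "q = r + Polynomial.smult c (B (Suc d))"
      unfolding r_def by simp
    ultimately have "L q = c * L (B (Suc d))"
      by (metis add smult add_0)
    then show ?case
      using dual[of "Suc d"] Suc.prems deg[of "Suc d"] unfolding c_def by auto
  qed
  from this[of q n] q show ?thesis by simp
qed

lemma biorthonormal_moment:
  assumes w: "continuous_on (sphere 0 1) w" and bi: "biorthonormal w \<kappa> \<phi> \<phi>b"
    and q: "degree q \<le> n"
  shows "circle_mean (\<lambda>\<zeta>. w \<zeta> * poly (\<phi> n) \<zeta> * poly q (1 / \<zeta>)) = coeff q n / \<kappa> n"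
proof -
  have c: "continuous_on (sphere 0 1) (\<lambda>\<zeta>. w \<zeta> * poly (\<phi> n) \<zeta> * poly q (1 / \<zeta>))" for q
    using w by (auto intro!: continuous_intros)
  have lc: "lead_coeff (\<phi>b m) = \<kappa> m" "degree (\<phi>b m) = m" "\<kappa> m \<noteq> 0" for m
    using bi unfolding biorthonormal_def by blast+
  have "circle_mean (\<lambda>\<zeta>. w \<zeta> * poly (\<phi> n) \<zeta> * poly q (1 / \<zeta>)) = coeff q n / lead_coeff (\<phi>b n)"
  proof (rule functional_of_dual_basis[where B = \<phi>b])
    fix p q :: "complex poly" and a
    show "circle_mean (\<lambda>\<zeta>. w \<zeta> * poly (\<phi> n) \<zeta> * poly (p + q) (1 / \<zeta>)) =
        circle_mean (\<lambda>\<zeta>. w \<zeta> * poly (\<phi> n) \<zeta> * poly p (1 / \<zeta>)) +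
        circle_mean (\<lambda>\<zeta>. w \<zeta> * poly (\<phi> n) \<zeta> * poly q (1 / \<zeta>))"
      by (subst circle_mean_add [symmetric], rule c, rule c) (simp add: algebra_simps)
    show "circle_mean (\<lambda>\<zeta>. w \<zeta> * poly (\<phi> n) \<zeta> * poly (Polynomial.smult a p) (1 / \<zeta>)) =
        a * circle_mean (\<lambda>\<zeta>. w \<zeta> * poly (\<phi> n) \<zeta> * poly p (1 / \<zeta>))"
      by (subst circle_mean_cmult [symmetric], rule c) (simp add: algebra_simps)
  qed (use bi q lc in \<open>auto simp: biorthonormal_def\<close>)
  then show ?thesis by (simp only: lc(1))
qed

lemma biorthonormal_moment_bar:
  assumes w: "continuous_on (sphere 0 1) w" and bi: "biorthonormal w \<kappa> \<phi> \<phi>b"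
    and q: "degree q \<le> n"
  shows "circle_mean (\<lambda>\<zeta>. w \<zeta> * poly q \<zeta> * poly (\<phi>b n) (1 / \<zeta>)) = coeff q n / \<kappa> n"
proof -
  have c: "continuous_on (sphere 0 1) (\<lambda>\<zeta>. w \<zeta> * poly q \<zeta> * poly (\<phi>b n) (1 / \<zeta>))" for q
    using w by (auto intro!: continuous_intros)
  have lc: "lead_coeff (\<phi> m) = \<kappa> m" "degree (\<phi> m) = m" "\<kappa> m \<noteq> 0" for m
    using bi unfolding biorthonormal_def by blast+
  have "circle_mean (\<lambda>\<zeta>. w \<zeta> * poly q \<zeta> * poly (\<phi>b n) (1 / \<zeta>)) = coeff q n / lead_coeff (\<phi> n)"
  proof (rule functional_of_dual_basis[where B = \<phi>])
    fix p q :: "complex poly" and a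
    show "circle_mean (\<lambda>\<zeta>. w \<zeta> * poly (p + q) \<zeta> * poly (\<phi>b n) (1 / \<zeta>)) =
        circle_mean (\<lambda>\<zeta>. w \<zeta> * poly p \<zeta> * poly (\<phi>b n) (1 / \<zeta>)) +
        circle_mean (\<lambda>\<zeta>. w \<zeta> * poly q \<zeta> * poly (\<phi>b n) (1 / \<zeta>))"
      by (subst circle_mean_add [symmetric], rule c, rule c) (simp add: algebra_simps)
    show "circle_mean (\<lambda>\<zeta>. w \<zeta> * poly (Polynomial.smult a p) \<zeta> * poly (\<phi>b n) (1 / \<zeta>)) =
        a * circle_mean (\<lambda>\<zeta>. w \<zeta> * poly p \<zeta> * poly (\<phi>b n) (1 / \<zeta>))"
      by (subst circle_mean_cmult [symmetric], rule c) (simp add: algebra_simps)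
  qed (use bi q lc in \<open>auto simp: biorthonormal_def\<close>)
  then show ?thesis by (simp only: lc(1))
qed

section \<open>The Casoratians\<close>

text \<open>
  The Cauchy transforms of the next two densities are \<open>\<epsilon>\<^sub>n/z\<^sup>n\<close> and, for the starred function,
  \<open>\<epsilon>\<^sup>*\<^sub>n/z\<^sup>n\<^sup>+\<^sup>1\<close>, extended to \<open>z = 0\<close>.
\<close>

definition \<epsilon>_density :: "(complex \<Rightarrow> complex) \<Rightarrow> (nat \<Rightarrow> complex poly) \<Rightarrow> nat \<Rightarrow> complex \<Rightarrow> complex"
  where "\<epsilon>_density w \<phi> n \<zeta> = 2 * (w \<zeta> * poly (\<phi> n) \<zeta>) * (\<zeta> / \<zeta> ^ n)"

definition \<epsilon>s_density :: "(complex \<Rightarrow> complex) \<Rightarrow> (nat \<Rightarrow> complex poly) \<Rightarrow> nat \<Rightarrow> complex \<Rightarrow> complex"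
  where "\<epsilon>s_density w \<phi>b n \<zeta> = - 2 * (w \<zeta> * poly (\<phi>b n) (1 / \<zeta>))"

context
  fixes w :: "complex \<Rightarrow> complex" and \<kappa> :: "nat \<Rightarrow> complex" and \<phi> \<phi>b :: "nat \<Rightarrow> complex poly"
  assumes w: "continuous_on (sphere 0 1) w" and bi: "biorthonormal w \<kappa> \<phi> \<phi>b"
begin

lemma \<kappa>_nonzero: "\<kappa> n \<noteq> 0"
  and degree_\<phi>: "degree (\<phi> n) = n" and coeff_\<phi>: "coeff (\<phi> n) n = \<kappa> n"
  and degree_\<phi>b: "degree (\<phi>b n) = n" and coeff_\<phi>b: "coeff (\<phi>b n) n = \<kappa> n"
  using bi unfolding biorthonormal_def by metis+

lemma continuous_\<epsilon>_density: "continuous_on (sphere 0 1) (\<epsilon>_density w \<phi> n)"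
  unfolding \<epsilon>_density_def using w by (auto intro!: continuous_intros)

lemma continuous_\<epsilon>s_density: "continuous_on (sphere 0 1) (\<epsilon>s_density w \<phi>b n)"
  unfolding \<epsilon>s_density_def using w by (auto intro!: continuous_intros)

lemma moment_\<epsilon>_density:
  assumes "i < n"
  shows "circle_mean (\<lambda>\<zeta>. \<zeta> ^ i * \<epsilon>_density w \<phi> n \<zeta>) = 0"
proof -
  let ?q = "Polynomial.monom (2::complex) (n - Suc i)"
  have "circle_mean (\<lambda>\<zeta>. \<zeta> ^ i * \<epsilon>_density w \<phi> n \<zeta>)
      = circle_mean (\<lambda>\<zeta>. w \<zeta> * poly (\<phi> n) \<zeta> * poly ?q (1 / \<zeta>))"
  proof (rule circle_mean_cong)
    fix \<zeta> :: complex assume "norm \<zeta> = 1"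
    then have "\<zeta> \<noteq> 0" by auto
    then have "\<zeta> ^ i * (\<zeta> / \<zeta> ^ n) = (1 / \<zeta>) ^ (n - Suc i)"
      using assms by (simp add: power_diff field_simps)
    then show "\<zeta> ^ i * \<epsilon>_density w \<phi> n \<zeta> = w \<zeta> * poly (\<phi> n) \<zeta> * poly ?q (1 / \<zeta>)"
      unfolding \<epsilon>_density_def poly_monom by (metis mult.assoc mult.commute mult.left_commute)
  qed
  also have "\<dots> = coeff ?q n / \<kappa> n"
    by (rule biorthonormal_moment[OF w bi]) (auto intro: order.trans[OF degree_monom_le])
  finally show ?thesis using assms by simp
qed

lemma moment_\<epsilon>s_density:
  assumes "i \<le> n"
  shows "circle_mean (\<lambda>\<zeta>. \<zeta> ^ i * \<epsilon>s_density w \<phi>b n \<zeta>) = (if i = n then - 2 / \<kappa> n else 0)"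
proof -
  let ?q = "Polynomial.monom (- 2::complex) i"
  have "circle_mean (\<lambda>\<zeta>. \<zeta> ^ i * \<epsilon>s_density w \<phi>b n \<zeta>)
      = circle_mean (\<lambda>\<zeta>. w \<zeta> * poly ?q \<zeta> * poly (\<phi>b n) (1 / \<zeta>))"
    by (rule circle_mean_cong) (simp add: \<epsilon>s_density_def poly_monom)
  also have "\<dots> = coeff ?q n / \<kappa> n"
    by (rule biorthonormal_moment_bar[OF w bi])
       (use assms in \<open>auto intro: order.trans[OF degree_monom_le]\<close>)
  finally show ?thesis by simp
qed

text \<open>
  The first moment that does not vanish by orthogonality is found by pairing \<open>\<phi>\<^sub>n\<close> with
  \<open>\<zeta>\<^sup>-\<^sup>n \<phi>\<^sub>n\<^sub>+\<^sub>1(\<zeta>)\<close>: the mean is zero because \<open>\<zeta>\<^sup>-\<^sup>n \<phi>\<^sub>n(\<zeta>)\<close> is a polynomial of degree \<open>n\<close> in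
  \<open>1/\<zeta>\<close>, and all but two of its terms vanish.
\<close>

lemma leading_moment_\<epsilon>_density:
  "\<kappa> (Suc n) * circle_mean (\<lambda>\<zeta>. \<zeta> ^ n * \<epsilon>_density w \<phi> n \<zeta>) = - 2 * poly (\<phi> (Suc n)) 0 / \<kappa> n"
proof -
  define M where "M = circle_mean (\<lambda>\<zeta>. \<zeta> ^ n * \<epsilon>_density w \<phi> n \<zeta>)"
  define p where "p = \<phi> (Suc n)"
  let ?s = "p - Polynomial.monom (\<kappa> (Suc n)) (Suc n)"
  have degs: "degree ?s \<le> n"
  proof -
    have "degree ?s \<le> Suc n"
      by (intro degree_diff_le) (auto simp: p_def degree_\<phi> intro: order.trans[OF degree_monom_le])
    moreover have "coeff ?s (Suc n) = 0"
      by (simp add: p_def coeff_\<phi>)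
    ultimately show ?thesis
      by (metis degree_0 leading_coeff_0_iff le_SucE zero_le)
  qed
  \<comment> \<open>\<open>t(1/\<zeta>) = \<zeta>\<^sup>-\<^sup>n s(\<zeta>)\<close>, where \<open>s\<close> is \<open>p\<close> without its leading term; the monomial makes up for
    a drop of the degree of \<open>s\<close> below \<open>n\<close>.\<close>
  define t where "t = Polynomial.monom 1 (n - degree ?s) * reflect_poly ?s"
  have degt: "degree t \<le> n"
  proof -
    have "degree t \<le> degree (Polynomial.monom (1::complex) (n - degree ?s)) + degree (reflect_poly ?s)"
      unfolding t_def by (rule degree_mult_le)
    also have "\<dots> \<le> (n - degree ?s) + degree ?s"
      by (intro add_mono degree_monom_le degree_reflect_poly_le)
    finally show ?thesis using degs by simp
  qed
  have coefft: "coeff t n = poly p 0"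
    unfolding t_def using degs
    by (simp add: coeff_monom_mult coeff_reflect_poly poly_0_coeff_0)
  have polyt: "poly t (1 / \<zeta>) = poly ?s \<zeta> / \<zeta> ^ n" if "\<zeta> \<noteq> 0" for \<zeta>
  proof -
    have "poly t (1 / \<zeta>) = (1 / \<zeta>) ^ (n - degree ?s) * ((1 / \<zeta>) ^ degree ?s * poly ?s \<zeta>)"
      unfolding t_def poly_mult poly_monom
      using that by (simp add: poly_reflect_poly_nz)
    also have "\<dots> = (1 / \<zeta>) ^ (n - degree ?s + degree ?s) * poly ?s \<zeta>"
      by (simp only: power_add mult.assoc)
    finally show ?thesis using degs by (simp add: power_divide)
  qed
  let ?f = "\<lambda>\<zeta>. w \<zeta> * poly (\<phi> n) \<zeta> * poly t (1 / \<zeta>)"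
  let ?g = "\<lambda>\<zeta>. w \<zeta> * poly p \<zeta> * poly (reflect_poly (\<phi> n)) (1 / \<zeta>)"
  have f: "circle_mean ?f = poly p 0 / \<kappa> n"
    using biorthonormal_moment[OF w bi degt] coefft by simp
  have "circle_mean ?g = coeff (reflect_poly (\<phi> n)) (Suc n) / \<kappa> (Suc n)"
    unfolding p_def
    by (rule biorthonormal_moment[OF w bi]) (metis degree_reflect_poly_le degree_\<phi> le_SucI)
  then have g: "circle_mean ?g = 0"
    by (simp add: coeff_reflect_poly degree_\<phi>)
  have "circle_mean ?g = circle_mean (\<lambda>\<zeta>. \<kappa> (Suc n) / 2 * (\<zeta> ^ n * \<epsilon>_density w \<phi> n \<zeta>) + ?f \<zeta>)"
  proof (rule circle_mean_cong)
    fix \<zeta> :: complex assume "norm \<zeta> = 1"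
    then have z: "\<zeta> \<noteq> 0" by auto
    have "poly (reflect_poly (\<phi> n)) (1 / \<zeta>) = poly (\<phi> n) \<zeta> / \<zeta> ^ n"
      using z by (simp add: poly_reflect_poly_nz degree_\<phi> power_divide)
    moreover have "poly p \<zeta> = \<kappa> (Suc n) * \<zeta> ^ Suc n + poly ?s \<zeta>"
      by (simp add: poly_monom)
    ultimately show "?g \<zeta> = \<kappa> (Suc n) / 2 * (\<zeta> ^ n * \<epsilon>_density w \<phi> n \<zeta>) + ?f \<zeta>"
      using z unfolding \<epsilon>_density_def polyt[OF z] by (simp add: field_simps)
  qed
  also have "\<dots> = \<kappa> (Suc n) / 2 * M + circle_mean ?f"
    unfolding M_def
    by (subst circle_mean_add, (auto intro!: continuous_intros continuous_\<epsilon>_density w)[2],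
        subst circle_mean_cmult) (auto intro!: continuous_intros continuous_\<epsilon>_density)
  finally show ?thesis
    using f g unfolding M_def p_def by (simp add: field_simps eq_neg_iff_add_eq_0)
qed

lemma casoratian_\<epsilon>:
  assumes "norm z \<noteq> 1"
  shows "poly (\<phi> (Suc n)) z * cauchy_transform (\<epsilon>_density w \<phi> n) z
       - z * poly (\<phi> n) z * cauchy_transform (\<epsilon>_density w \<phi> (Suc n)) z
       = 2 * poly (\<phi> (Suc n)) 0 / \<kappa> n"
proof -
  have "poly (\<phi> (Suc n)) z * cauchy_transform (\<epsilon>_density w \<phi> n) z
      - z * poly (\<phi> n) z * cauchy_transform (\<epsilon>_density w \<phi> (Suc n)) z
      = - coeff (\<phi> (Suc n)) (Suc n) * circle_mean (\<lambda>\<zeta>. \<zeta> ^ n * \<epsilon>_density w \<phi> n \<zeta>)"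
  proof (rule casoratian_cauchy_transform)
    fix \<zeta> :: complex assume "norm \<zeta> = 1"
    then have "\<zeta> \<noteq> 0" by auto
    then show "poly (\<phi> (Suc n)) \<zeta> * \<epsilon>_density w \<phi> n \<zeta> =
        \<zeta> * poly (\<phi> n) \<zeta> * \<epsilon>_density w \<phi> (Suc n) \<zeta>"
      by (simp add: \<epsilon>_density_def field_simps)
  qed (simp_all add: assms continuous_\<epsilon>_density degree_\<phi> moment_\<epsilon>_density)
  also have "\<dots> = 2 * poly (\<phi> (Suc n)) 0 / \<kappa> n"
    using leading_moment_\<epsilon>_density[of n] by (simp add: coeff_\<phi>)
  finally show ?thesis .
qed

lemma casoratian_\<epsilon>s:
  assumes "norm z \<noteq> 1"
  shows "poly (recip_poly \<phi>b (Suc n)) z * cauchy_transform (\<epsilon>s_density w \<phi>b n) z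
       - z * poly (recip_poly \<phi>b n) z * cauchy_transform (\<epsilon>s_density w \<phi>b (Suc n)) z
       = 2 * poly (\<phi>b (Suc n)) 0 / \<kappa> n"
proof -
  have deg: "degree (recip_poly \<phi>b m) \<le> m" for m
    unfolding recip_poly_def by (metis degree_reflect_poly_le degree_\<phi>b)
  have "poly (recip_poly \<phi>b (Suc n)) z * cauchy_transform (\<epsilon>s_density w \<phi>b n) z
      - z * poly (recip_poly \<phi>b n) z * cauchy_transform (\<epsilon>s_density w \<phi>b (Suc n)) z
      = - coeff (recip_poly \<phi>b (Suc n)) (Suc n) * circle_mean (\<lambda>\<zeta>. \<zeta> ^ n * \<epsilon>s_density w \<phi>b n \<zeta>)"
  proof (rule casoratian_cauchy_transform)
    fix \<zeta> :: complex assume "norm \<zeta> = 1"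
    then have "\<zeta> \<noteq> 0" by auto
    then show "poly (recip_poly \<phi>b (Suc n)) \<zeta> * \<epsilon>s_density w \<phi>b n \<zeta> =
        \<zeta> * poly (recip_poly \<phi>b n) \<zeta> * \<epsilon>s_density w \<phi>b (Suc n) \<zeta>"
      by (simp add: \<epsilon>s_density_def recip_poly_def poly_reflect_poly_nz degree_\<phi>b inverse_eq_divide)
  qed (simp_all add: assms continuous_\<epsilon>s_density deg moment_\<epsilon>s_density)
  also have "\<dots> = 2 * poly (\<phi>b (Suc n)) 0 / \<kappa> n"
    by (simp add: moment_\<epsilon>s_density recip_poly_def coeff_reflect_poly degree_\<phi>b poly_0_coeff_0)
  finally show ?thesis .
qed

text \<open>
  The kernel satisfies \<open>(\<zeta> + z)/(\<zeta> - z) + 1 = 2\<zeta>/(\<zeta> - z)\<close>. The summand \<open>1\<close> contributes the mean of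
  \<open>w \<phi>\<^sub>n\<close>, which vanishes for \<open>n \<ge> 1\<close> and is the separate term \<open>1/\<kappa>\<^sub>0\<close> of \<open>\<epsilon>\<^sub>0\<close>; the power
  \<open>z\<^sup>n\<close> is pulled out by \<open>poly_times_cauchy_transform\<close>.
\<close>

lemma assoc_fun_eq_cauchy_transform:
  assumes z: "norm z \<noteq> 1"
  shows "assoc_fun w \<kappa> \<phi> n z = z ^ n * cauchy_transform (\<epsilon>_density w \<phi> n) z"
proof -
  let ?f = "\<lambda>\<zeta>. w \<zeta> * poly (\<phi> n) \<zeta>"
  let ?k = "\<lambda>\<zeta>. (\<zeta> + z) / (\<zeta> - z)"
  have ne: "\<zeta> \<noteq> z" if "norm \<zeta> = 1" for \<zeta>
    using that z by auto
  have kw: "continuous_on (sphere 0 1) (\<lambda>\<zeta>. ?k \<zeta> * w \<zeta>)"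
    by (intro continuous_intros w) (use ne in auto)
  have f: "continuous_on (sphere 0 1) ?f"
    by (auto intro!: continuous_intros w)
  have kf: "continuous_on (sphere 0 1) (\<lambda>\<zeta>. ?k \<zeta> * w \<zeta> * poly (\<phi> n) \<zeta>)"
    by (rule continuous_on_mult[OF kw]) (auto intro!: continuous_intros)
  have "z ^ n * cauchy_transform (\<epsilon>_density w \<phi> n) z =
      cauchy_transform (\<lambda>\<zeta>. \<zeta> ^ n * \<epsilon>_density w \<phi> n \<zeta>) z"
    using poly_times_cauchy_transform[OF continuous_\<epsilon>_density z, of "Polynomial.monom 1 n" n n]
      moment_\<epsilon>_density[of _ n]
    by (simp add: poly_monom degree_monom_eq)
  also have "\<dots> = circle_mean (\<lambda>\<zeta>. ?k \<zeta> * w \<zeta> * poly (\<phi> n) \<zeta> + ?f \<zeta>)"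
    unfolding cauchy_transform_def
  proof (rule circle_mean_cong)
    fix \<zeta> :: complex assume \<zeta>: "norm \<zeta> = 1"
    then have 1: "\<zeta> ^ n * \<epsilon>_density w \<phi> n \<zeta> = 2 * \<zeta> * ?f \<zeta>"
      by (auto simp: \<epsilon>_density_def)
    have 2: "?k \<zeta> + 1 = 2 * \<zeta> / (\<zeta> - z)"
      using ne[OF \<zeta>] by (simp add: field_simps)
    have "?k \<zeta> * w \<zeta> * poly (\<phi> n) \<zeta> + ?f \<zeta> = (?k \<zeta> + 1) * ?f \<zeta>"
      by (simp only: distrib_right mult_1_left mult.assoc)
    then show "\<zeta> ^ n * \<epsilon>_density w \<phi> n \<zeta> / (\<zeta> - z) = ?k \<zeta> * w \<zeta> * poly (\<phi> n) \<zeta> + ?f \<zeta>"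
      unfolding 1 2 by simp
  qed
  also have "\<dots> = circle_mean (\<lambda>\<zeta>. ?k \<zeta> * w \<zeta> * poly (\<phi> n) \<zeta>) + circle_mean ?f"
    by (intro circle_mean_add kf f)
  also have "circle_mean ?f = (if n = 0 then 1 / \<kappa> 0 else 0)"
    using biorthonormal_moment[OF w bi, of 1 n] by simp
  finally have *: "z ^ n * cauchy_transform (\<epsilon>_density w \<phi> n) z =
      circle_mean (\<lambda>\<zeta>. ?k \<zeta> * w \<zeta> * poly (\<phi> n) \<zeta>) + (if n = 0 then 1 / \<kappa> 0 else 0)" .
  have "poly (\<phi> 0) \<zeta> = \<kappa> 0" for \<zeta>
    by (rule degree_eq_zeroE[OF degree_\<phi>[of 0]]) (use coeff_\<phi>[of 0] in simp)
  then have "circle_mean (\<lambda>\<zeta>. ?k \<zeta> * w \<zeta> * poly (\<phi> 0) \<zeta>) = circle_mean (\<lambda>\<zeta>. \<kappa> 0 * (?k \<zeta> * w \<zeta>))"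
    by (simp only: mult.commute)
  also have "\<dots> = \<kappa> 0 * caratheodory_fun w z"
    unfolding caratheodory_fun_def by (rule circle_mean_cmult[OF kw])
  finally show ?thesis
    unfolding assoc_fun_def * by (cases "n = 0") simp_all
qed

text \<open>
  Here \<open>1 - (\<zeta> + z)/(\<zeta> - z) = -2z/(\<zeta> - z)\<close> provides one more power of \<open>z\<close> directly.
\<close>

lemma assoc_fun_star_eq_cauchy_transform:
  assumes z: "norm z \<noteq> 1"
  shows "assoc_fun_star w \<kappa> \<phi>b n z = z ^ Suc n * cauchy_transform (\<epsilon>s_density w \<phi>b n) z"
proof -
  let ?f = "\<lambda>\<zeta>. w \<zeta> * poly (\<phi>b n) (1 / \<zeta>)"
  let ?k = "\<lambda>\<zeta>. (\<zeta> + z) / (\<zeta> - z)"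
  have ne: "\<zeta> \<noteq> z" if "norm \<zeta> = 1" for \<zeta>
    using that z by auto
  have kw: "continuous_on (sphere 0 1) (\<lambda>\<zeta>. ?k \<zeta> * w \<zeta>)"
    by (intro continuous_intros w) (use ne in auto)
  have f: "continuous_on (sphere 0 1) ?f"
    by (auto intro!: continuous_intros w)
  have kf: "continuous_on (sphere 0 1) (\<lambda>\<zeta>. ?k \<zeta> * w \<zeta> * poly (\<phi>b n) (1 / \<zeta>))"
    by (rule continuous_on_mult[OF kw]) (auto intro!: continuous_intros)
  have c: "continuous_on (sphere 0 1) (\<lambda>\<zeta>. \<epsilon>s_density w \<phi>b n \<zeta> / (\<zeta> - z))"
    using ne by (auto intro!: continuous_intros continuous_\<epsilon>s_density)
  have "z * cauchy_transform (\<epsilon>s_density w \<phi>b n) z =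
      circle_mean (\<lambda>\<zeta>. ?f \<zeta> - ?k \<zeta> * w \<zeta> * poly (\<phi>b n) (1 / \<zeta>))"
    unfolding cauchy_transform_def circle_mean_cmult [symmetric, OF c]
  proof (rule circle_mean_cong)
    fix \<zeta> :: complex assume \<zeta>: "norm \<zeta> = 1"
    have "1 - ?k \<zeta> = - 2 * z / (\<zeta> - z)"
      using ne[OF \<zeta>] by (simp add: field_simps)
    moreover have "?f \<zeta> - ?k \<zeta> * w \<zeta> * poly (\<phi>b n) (1 / \<zeta>) = (1 - ?k \<zeta>) * ?f \<zeta>"
      by (simp only: left_diff_distrib mult_1_left mult.assoc)
    ultimately show "z * (\<epsilon>s_density w \<phi>b n \<zeta> / (\<zeta> - z)) =
        ?f \<zeta> - ?k \<zeta> * w \<zeta> * poly (\<phi>b n) (1 / \<zeta>)"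
      by (simp add: \<epsilon>s_density_def)
  qed
  also have "\<dots> = circle_mean ?f - circle_mean (\<lambda>\<zeta>. ?k \<zeta> * w \<zeta> * poly (\<phi>b n) (1 / \<zeta>))"
    by (intro circle_mean_diff kf f)
  also have "circle_mean ?f = (if n = 0 then 1 / \<kappa> 0 else 0)"
    using biorthonormal_moment_bar[OF w bi, of 1 n] by simp
  finally have *: "z * cauchy_transform (\<epsilon>s_density w \<phi>b n) z =
      (if n = 0 then 1 / \<kappa> 0 else 0) - circle_mean (\<lambda>\<zeta>. ?k \<zeta> * w \<zeta> * poly (\<phi>b n) (1 / \<zeta>))" .
  have "poly (\<phi>b 0) \<zeta> = \<kappa> 0" for \<zeta>
    by (rule degree_eq_zeroE[OF degree_\<phi>b[of 0]]) (use coeff_\<phi>b[of 0] in simp)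
  then have "circle_mean (\<lambda>\<zeta>. ?k \<zeta> * w \<zeta> * poly (\<phi>b 0) (1 / \<zeta>)) = circle_mean (\<lambda>\<zeta>. \<kappa> 0 * (?k \<zeta> * w \<zeta>))"
    by (simp only: mult.commute)
  also have "\<dots> = \<kappa> 0 * caratheodory_fun w z"
    unfolding caratheodory_fun_def by (rule circle_mean_cmult[OF kw])
  finally have 0: "circle_mean (\<lambda>\<zeta>. ?k \<zeta> * w \<zeta> * poly (\<phi>b 0) (1 / \<zeta>)) = \<kappa> 0 * caratheodory_fun w z" .
  have "z ^ Suc n * cauchy_transform (\<epsilon>s_density w \<phi>b n) z =
      z ^ n * (z * cauchy_transform (\<epsilon>s_density w \<phi>b n) z)"
    by (simp only: power_Suc ac_simps)
  then show ?thesis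
    unfolding assoc_fun_star_def * using 0 by (cases "n = 0") simp_all
qed

end

section \<open>Continuity of the weight\<close>

text \<open>
  On a smaller annulus between radii \<open>s < t\<close> every term is at most the sum of its absolute values
  at \<open>s\<close> and at \<open>t\<close>, and complex series that converge unconditionally converge absolutely; so the
  series converges uniformly there.
\<close>

lemma continuous_on_laurent_series:
  fixes c :: "int \<Rightarrow> complex"
  assumes r: "0 \<le> r"
    and sum: "\<And>z. r < norm z \<Longrightarrow> norm z < R \<Longrightarrow> ((\<lambda>k. c k * z powi k) has_sum f z) UNIV"
  shows "continuous_on {z. r < norm z \<and> norm z < R} f"
proof -
  have "isCont f z" if z: "r < norm z" "norm z < R" for z
  proof -
    obtain s where s: "r < s" "s < norm z" using z(1) dense by blast
    obtain t where t: "norm z < t" "t < R" using z(2) dense by blast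
    define A where "A = {u :: complex. s < norm u \<and> norm u < t}"
    have A: "open A" "z \<in> A"
      unfolding A_def using s t
      by (auto intro!: open_Collect_conj open_Collect_less continuous_intros)
    have abs: "(\<lambda>k. norm (c k * of_real x powi k)) summable_on UNIV" if "r < x" "x < R" for x
    proof -
      have "(\<lambda>k. c k * of_real x powi k) summable_on UNIV"
        using sum[of "of_real x"] that r by (auto simp: summable_on_def)
      then show ?thesis
        by (simp only: summable_on_iff_abs_summable_on_complex)
    qed
    define M where "M = (\<lambda>k. norm (c k * of_real s powi k) + norm (c k * of_real t powi k))"
    have M: "M summable_on UNIV"
      unfolding M_def using s t r by (intro summable_on_add abs) linarith+
    have bound: "norm (c k * u powi k) \<le> M k" if "u \<in> A" for k u
    proof -
      have u: "s < norm u" "norm u < t" using that by (auto simp: A_def)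
      have "norm u powi k \<le> s powi k + t powi k"
      proof (cases "0 \<le> k")
        case True
        have "norm u powi k \<le> t powi k"
          using u True by (intro power_int_mono) auto
        then show ?thesis
          using s r by (smt (verit) zero_le_power_int)
      next
        case False
        have "norm u powi k \<le> s powi k"
          using u False s r by (intro power_int_antimono) auto
        then show ?thesis
          using u by (smt (verit) zero_le_power_int norm_ge_zero)
      qed
      then have "norm (c k) * norm u powi k \<le> norm (c k) * (s powi k + t powi k)"
        by (rule mult_left_mono) simp
      also have "\<dots> = M k"
        using s t r by (simp add: M_def norm_mult norm_power_int distrib_left)
      finally show ?thesis by (simp add: norm_mult norm_power_int)
    qed
    have lim: "uniform_limit A (\<lambda>X u. \<Sum>k\<in>X. c k * u powi k) f (finite_subsets_at_top UNIV)"
      by (rule Weierstrass_m_test_general'[OF _ _ M]) (use bound sum s t in \<open>auto simp: A_def\<close>)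
    have "continuous_on A f"
    proof (rule uniform_limit_theorem[OF _ lim])
      have "u \<noteq> 0" if "u \<in> A" for u
        using that s r by (auto simp: A_def)
      then show "\<forall>\<^sub>F X in finite_subsets_at_top UNIV. continuous_on A (\<lambda>u. \<Sum>k\<in>X. c k * u powi k)"
        by (intro always_eventually allI continuous_intros) auto
    qed simp
    then show ?thesis
      using A continuous_on_eq_continuous_at by blast
  qed
  then show ?thesis
    by (auto intro: continuous_at_imp_continuous_on)
qed

section \<open>Solving for the coefficient functions\<close>

text \<open>
  With \<open>W = z u\<close> the factor \<open>z\<^sup>m\<close> cancels from the second equation, and the determinant that is left
  is the constant \<^term>\<open>c\<close>. Both pairs of functions are instances, the starred one after a
  change of sign of both coefficients.
\<close>

lemma cramer_coefficients:
  fixes p0 p1 e0 e1 a b u V :: "complex \<Rightarrow> complex" and c :: complex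
  assumes S: "open S"
    and hol: "p0 holomorphic_on S" "p1 holomorphic_on S" "a holomorphic_on S" "b holomorphic_on S"
      "u holomorphic_on S" "V holomorphic_on S"
    and e0: "\<And>z. z \<in> S \<Longrightarrow> e0 z = z ^ m * a z" and e1: "\<And>z. z \<in> S \<Longrightarrow> e1 z = z ^ m * b z"
    and cas: "\<And>z. z \<in> S \<Longrightarrow> p1 z * a z - p0 z * b z = c" and c: "c \<noteq> 0"
  shows "\<exists>\<Theta> \<Omega>. \<Theta> holomorphic_on S \<and> \<Omega> holomorphic_on S \<and>
    (\<forall>z\<in>S. z * u z * deriv p0 z = \<Theta> z * p1 z - (\<Omega> z + V z) * p0 z \<and>
           z * u z * deriv e0 z = \<Theta> z * e1 z - (\<Omega> z - V z) * e0 z)"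
proof -
  define f where "f = (\<lambda>z. z * u z * deriv p0 z + V z * p0 z)"
  define g where "g = (\<lambda>z. of_nat m * u z * a z + z * u z * deriv a z - V z * a z)"
  define \<Theta> where "\<Theta> = (\<lambda>z. (f z * a z - g z * p0 z) / c)"
  define \<Omega> where "\<Omega> = (\<lambda>z. (f z * b z - g z * p1 z) / c)"
  have "f holomorphic_on S" "g holomorphic_on S"
    unfolding f_def g_def using hol S by (auto intro!: holomorphic_intros)
  then have "\<Theta> holomorphic_on S" "\<Omega> holomorphic_on S"
    unfolding \<Theta>_def \<Omega>_def using hol c by (auto intro!: holomorphic_intros)
  moreover have "z * u z * deriv p0 z = \<Theta> z * p1 z - (\<Omega> z + V z) * p0 z"
    and "z * u z * deriv e0 z = \<Theta> z * e1 z - (\<Omega> z - V z) * e0 z" if z: "z \<in> S" for z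
  proof -
    have "\<Theta> z * p1 z - \<Omega> z * p0 z = f z * (p1 z * a z - p0 z * b z) / c"
      unfolding \<Theta>_def \<Omega>_def by (simp add: diff_divide_distrib algebra_simps)
    then have 1: "\<Theta> z * p1 z - \<Omega> z * p0 z = f z"
      using cas[OF z] c by simp
    have "\<Theta> z * b z - \<Omega> z * a z = g z * (p1 z * a z - p0 z * b z) / c"
      unfolding \<Theta>_def \<Omega>_def by (simp add: diff_divide_distrib algebra_simps)
    then have 2: "\<Theta> z * b z - \<Omega> z * a z = g z"
      using cas[OF z] c by simp
    show "z * u z * deriv p0 z = \<Theta> z * p1 z - (\<Omega> z + V z) * p0 z"
      using 1 unfolding f_def by (simp add: algebra_simps)
    have "(a has_field_derivative deriv a z) (at z)"
      using hol(3) S z by (rule holomorphic_derivI)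
    then have "((\<lambda>z. z ^ m * a z) has_field_derivative
        of_nat m * z ^ (m - 1) * a z + z ^ m * deriv a z) (at z)"
      by (auto intro!: derivative_eq_intros)
    then have "(e0 has_field_derivative of_nat m * z ^ (m - 1) * a z + z ^ m * deriv a z) (at z)"
      by (rule has_field_derivative_transform_within_open[OF _ S z]) (simp add: e0)
    then have "deriv e0 z = of_nat m * z ^ (m - 1) * a z + z ^ m * deriv a z"
      by (rule DERIV_imp_deriv)
    then have "z * u z * deriv e0 z = z ^ m * (g z + V z * a z)"
      unfolding g_def by (cases m) (simp_all add: algebra_simps)
    also have "\<dots> = \<Theta> z * e1 z - (\<Omega> z - V z) * e0 z"
      unfolding 2 [symmetric] e0[OF z] e1[OF z] by (simp add: algebra_simps)
    finally show "z * u z * deriv e0 z = \<Theta> z * e1 z - (\<Omega> z - V z) * e0 z" .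
  qed
  ultimately show ?thesis by blast
qed

theorem proposition2p6:
  fixes D :: "complex set"
    and w :: "complex \<Rightarrow> complex"
    and \<kappa> :: "nat \<Rightarrow> complex"
    and \<phi> \<phi>b :: "nat \<Rightarrow> complex poly"
  assumes D: "cut_plane D"
    and w_hol: "w holomorphic_on D"
    and w_L1: "\<And>j::int. circle_L1 (\<lambda>z. z powi j * w z)"
    and w'_L1: "\<And>j::int. circle_L1 (\<lambda>z. z powi j * deriv w z)"
    and w_expansion: "\<exists>r R. 0 \<le> r \<and> r < 1 \<and> 1 < R \<and>
          (\<forall>z. r < norm z \<and> norm z < R \<longrightarrow>
               ((\<lambda>k::int. fourier_coeff w k * z powi k) has_sum w z) UNIV)"
    and dets: "\<And>n. n \<ge> 1 \<Longrightarrow> toeplitz_det w n \<noteq> 0"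
    and biorth: "biorthonormal w \<kappa> \<phi> \<phi>b"
    and \<phi>_0: "\<And>n. poly (\<phi> n) 0 \<noteq> 0"
    and \<phi>b_0: "\<And>n. poly (\<phi>b n) 0 \<noteq> 0"
  shows "\<exists>W V :: complex \<Rightarrow> complex.
      W holomorphic_on D \<and> V holomorphic_on D \<and>
      (\<exists>z\<in>D. W z \<noteq> 0) \<and>
      (\<forall>z\<in>D. W z * deriv w z = 2 * V z * w z) \<and>
      (\<exists>\<Theta> \<Omega> \<Theta>s \<Omega>s :: nat \<Rightarrow> complex \<Rightarrow> complex.
        \<forall>n.
          \<Theta> n holomorphic_on (D - sphere 0 1) \<and>
          \<Omega> n holomorphic_on (D - sphere 0 1) \<and>
          \<Theta>s n holomorphic_on (D - sphere 0 1) \<and>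
          \<Omega>s n holomorphic_on (D - sphere 0 1) \<and>
          (\<forall>z \<in> D - sphere 0 1.
            W z * deriv (poly (\<phi> n)) z =
              \<Theta> n z * poly (\<phi> (Suc n)) z - (\<Omega> n z + V z) * poly (\<phi> n) z \<and>
            W z * deriv (poly (recip_poly \<phi>b n)) z =
              - \<Theta>s n z * poly (recip_poly \<phi>b (Suc n)) z
              + (\<Omega>s n z - V z) * poly (recip_poly \<phi>b n) z \<and>
            W z * deriv (assoc_fun w \<kappa> \<phi> n) z =
              \<Theta> n z * assoc_fun w \<kappa> \<phi> (Suc n) z - (\<Omega> n z - V z) * assoc_fun w \<kappa> \<phi> n z \<and>
            W z * deriv (assoc_fun_star w \<kappa> \<phi>b n) z =
              - \<Theta>s n z * assoc_fun_star w \<kappa> \<phi>b (Suc n) z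
              + (\<Omega>s n z + V z) * assoc_fun_star w \<kappa> \<phi>b n z))"
proof -
  obtain r R where rR: "0 \<le> r" "r < 1" "1 < R"
    and exp: "\<And>z. r < norm z \<Longrightarrow> norm z < R \<Longrightarrow>
      ((\<lambda>k::int. fourier_coeff w k * z powi k) has_sum w z) UNIV"
    using w_expansion by blast
  define A where "A = {z :: complex. r < norm z \<and> norm z < R}"
  have A: "open A"
    unfolding A_def by (auto intro!: open_Collect_conj open_Collect_less continuous_intros)
  have contA: "continuous_on A w"
    unfolding A_def using rR(1) exp by (rule continuous_on_laurent_series)
  have cont: "continuous_on (sphere 0 1) w"
    using contA by (rule continuous_on_subset) (use rR in \<open>auto simp: A_def\<close>)
  have D_open: "open D" and D_dense: "closure D = UNIV"
    using D by (auto simp: cut_plane_def)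
  define S where "S = D - sphere 0 1"
  have S: "open S" "S \<inter> sphere 0 1 = {}"
    using D_open unfolding S_def by auto
  define V where "V = (\<lambda>z. z * deriv w z / 2)"
  have V: "V holomorphic_on D"
    unfolding V_def using w_hol D_open by (auto intro!: holomorphic_intros)
  have wS: "w holomorphic_on S" and VS: "V holomorphic_on S"
    using w_hol V holomorphic_on_subset unfolding S_def by blast+

  \<comment> \<open>The weight cannot vanish on the whole circle, so it does not vanish on some open set near the
    circle, which the dense domain has to meet.\<close>
  have "\<exists>\<zeta>. norm \<zeta> = 1 \<and> w \<zeta> \<noteq> 0"
  proof (rule ccontr)
    assume "\<not> ?thesis"
    then have "circle_mean (\<lambda>\<zeta>. w \<zeta> * poly (\<phi> 0) \<zeta> * poly (\<phi>b 0) (1 / \<zeta>)) = circle_mean (\<lambda>\<zeta>. 0)"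
      by (intro circle_mean_cong) simp
    then show False
      using biorth by (simp add: biorthonormal_def circle_mean_def)
  qed
  then obtain \<zeta> where \<zeta>: "norm \<zeta> = 1" "w \<zeta> \<noteq> 0" by blast
  have "open (A \<inter> (\<lambda>z. z * w z) -` (- {0}))"
    by (rule continuous_open_preimage[OF _ A]) (auto intro!: continuous_intros contA)
  moreover have "\<zeta> \<in> A \<inter> (\<lambda>z. z * w z) -` (- {0})"
    using \<zeta> rR by (auto simp: A_def)
  ultimately have "D \<inter> (A \<inter> (\<lambda>z. z * w z) -` (- {0})) \<noteq> {}"
    using D_dense by (metis open_Int_closure_eq_empty inf_commute inf_top_right empty_iff)
  then have W_nonzero: "\<exists>z\<in>D. z * w z \<noteq> 0" by auto

  have K: "cauchy_transform (\<epsilon>_density w \<phi> n) holomorphic_on S"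
    "cauchy_transform (\<epsilon>s_density w \<phi>b n) holomorphic_on S" for n
    using S by (auto intro!: holomorphic_cauchy_transform continuous_\<epsilon>_density[OF cont biorth]
        continuous_\<epsilon>s_density[OF cont biorth])
  have norm: "norm z \<noteq> 1" if "z \<in> S" for z
    using that by (auto simp: S_def)
  have \<kappa>: "\<kappa> n \<noteq> 0" for n
    using biorth by (auto simp: biorthonormal_def)

  have "\<exists>\<Theta> \<Omega>. \<Theta> holomorphic_on S \<and> \<Omega> holomorphic_on S \<and> (\<forall>z\<in>S.
      z * w z * deriv (poly (\<phi> n)) z =
        \<Theta> z * poly (\<phi> (Suc n)) z - (\<Omega> z + V z) * poly (\<phi> n) z \<and>
      z * w z * deriv (assoc_fun w \<kappa> \<phi> n) z =
        \<Theta> z * assoc_fun w \<kappa> \<phi> (Suc n) z - (\<Omega> z - V z) * assoc_fun w \<kappa> \<phi> n z)" for n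
  proof (rule cramer_coefficients[OF S(1), where m = n
        and a = "cauchy_transform (\<epsilon>_density w \<phi> n)"
        and b = "\<lambda>z. z * cauchy_transform (\<epsilon>_density w \<phi> (Suc n)) z"
        and c = "2 * poly (\<phi> (Suc n)) 0 / \<kappa> n"])
    fix z assume z: "z \<in> S"
    show "poly (\<phi> (Suc n)) z * cauchy_transform (\<epsilon>_density w \<phi> n) z -
        poly (\<phi> n) z * (z * cauchy_transform (\<epsilon>_density w \<phi> (Suc n)) z) =
        2 * poly (\<phi> (Suc n)) 0 / \<kappa> n"
      using casoratian_\<epsilon>[OF cont biorth norm[OF z], of n] by (simp add: ac_simps)
  qed (use K wS VS \<phi>_0 \<kappa> norm in
      \<open>auto intro!: holomorphic_intros simp: assoc_fun_eq_cauchy_transform[OF cont biorth]\<close>)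
  then obtain \<Theta> \<Omega> where \<Theta>: "\<And>n. \<Theta> n holomorphic_on S" "\<And>n. \<Omega> n holomorphic_on S"
    "\<And>n z. z \<in> S \<Longrightarrow> z * w z * deriv (poly (\<phi> n)) z =
        \<Theta> n z * poly (\<phi> (Suc n)) z - (\<Omega> n z + V z) * poly (\<phi> n) z"
    "\<And>n z. z \<in> S \<Longrightarrow> z * w z * deriv (assoc_fun w \<kappa> \<phi> n) z =
        \<Theta> n z * assoc_fun w \<kappa> \<phi> (Suc n) z - (\<Omega> n z - V z) * assoc_fun w \<kappa> \<phi> n z"
    by metis

  have "\<exists>\<Theta> \<Omega>. \<Theta> holomorphic_on S \<and> \<Omega> holomorphic_on S \<and> (\<forall>z\<in>S.
      z * w z * deriv (poly (recip_poly \<phi>b n)) z =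
        \<Theta> z * poly (recip_poly \<phi>b (Suc n)) z - (\<Omega> z + V z) * poly (recip_poly \<phi>b n) z \<and>
      z * w z * deriv (assoc_fun_star w \<kappa> \<phi>b n) z =
        \<Theta> z * assoc_fun_star w \<kappa> \<phi>b (Suc n) z - (\<Omega> z - V z) * assoc_fun_star w \<kappa> \<phi>b n z)" for n
  proof (rule cramer_coefficients[OF S(1), where m = "Suc n"
        and a = "cauchy_transform (\<epsilon>s_density w \<phi>b n)"
        and b = "\<lambda>z. z * cauchy_transform (\<epsilon>s_density w \<phi>b (Suc n)) z"
        and c = "2 * poly (\<phi>b (Suc n)) 0 / \<kappa> n"])
    fix z assume z: "z \<in> S"
    show "poly (recip_poly \<phi>b (Suc n)) z * cauchy_transform (\<epsilon>s_density w \<phi>b n) z -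
        poly (recip_poly \<phi>b n) z * (z * cauchy_transform (\<epsilon>s_density w \<phi>b (Suc n)) z) =
        2 * poly (\<phi>b (Suc n)) 0 / \<kappa> n"
      using casoratian_\<epsilon>s[OF cont biorth norm[OF z], of n] by (simp add: ac_simps)
  qed (use K wS VS \<phi>b_0 \<kappa> norm in
      \<open>auto intro!: holomorphic_intros simp: assoc_fun_star_eq_cauchy_transform[OF cont biorth]\<close>)
  then obtain \<Theta>' \<Omega>' where \<Theta>': "\<And>n. \<Theta>' n holomorphic_on S" "\<And>n. \<Omega>' n holomorphic_on S"
    "\<And>n z. z \<in> S \<Longrightarrow> z * w z * deriv (poly (recip_poly \<phi>b n)) z =
        \<Theta>' n z * poly (recip_poly \<phi>b (Suc n)) z - (\<Omega>' n z + V z) * poly (recip_poly \<phi>b n) z"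
    "\<And>n z. z \<in> S \<Longrightarrow> z * w z * deriv (assoc_fun_star w \<kappa> \<phi>b n) z =
        \<Theta>' n z * assoc_fun_star w \<kappa> \<phi>b (Suc n) z - (\<Omega>' n z - V z) * assoc_fun_star w \<kappa> \<phi>b n z"
    by metis

  show ?thesis
  proof (rule exI[of _ "\<lambda>z. z * w z"], rule exI[of _ V], intro conjI)
    show "(\<lambda>z. z * w z) holomorphic_on D"
      using w_hol by (auto intro!: holomorphic_intros)
    show "\<forall>z\<in>D. z * w z * deriv w z = 2 * V z * w z"
      by (simp add: V_def)
    show "\<exists>\<Theta> \<Omega> \<Theta>s \<Omega>s :: nat \<Rightarrow> complex \<Rightarrow> complex.
        \<forall>n.
          \<Theta> n holomorphic_on (D - sphere 0 1) \<and>
          \<Omega> n holomorphic_on (D - sphere 0 1) \<and>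
          \<Theta>s n holomorphic_on (D - sphere 0 1) \<and>
          \<Omega>s n holomorphic_on (D - sphere 0 1) \<and>
          (\<forall>z \<in> D - sphere 0 1.
            z * w z * deriv (poly (\<phi> n)) z =
              \<Theta> n z * poly (\<phi> (Suc n)) z - (\<Omega> n z + V z) * poly (\<phi> n) z \<and>
            z * w z * deriv (poly (recip_poly \<phi>b n)) z =
              - \<Theta>s n z * poly (recip_poly \<phi>b (Suc n)) z
              + (\<Omega>s n z - V z) * poly (recip_poly \<phi>b n) z \<and>
            z * w z * deriv (assoc_fun w \<kappa> \<phi> n) z =
              \<Theta> n z * assoc_fun w \<kappa> \<phi> (Suc n) z - (\<Omega> n z - V z) * assoc_fun w \<kappa> \<phi> n z \<and>
            z * w z * deriv (assoc_fun_star w \<kappa> \<phi>b n) z =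
              - \<Theta>s n z * assoc_fun_star w \<kappa> \<phi>b (Suc n) z
              + (\<Omega>s n z + V z) * assoc_fun_star w \<kappa> \<phi>b n z)"
      unfolding S_def [symmetric]
    proof (rule exI[of _ \<Theta>], rule exI[of _ \<Omega>], rule exI[of _ "\<lambda>n z. - \<Theta>' n z"],
        rule exI[of _ "\<lambda>n z. - \<Omega>' n z"], intro allI conjI ballI)
      fix n z assume z: "z \<in> S"
      show "z * w z * deriv (poly (recip_poly \<phi>b n)) z =
          - (- \<Theta>' n z) * poly (recip_poly \<phi>b (Suc n)) z + (- \<Omega>' n z - V z) * poly (recip_poly \<phi>b n) z"
        unfolding \<Theta>'(3)[OF z] by (simp add: left_diff_distrib distrib_right)
      show "z * w z * deriv (assoc_fun_star w \<kappa> \<phi>b n) z =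
          - (- \<Theta>' n z) * assoc_fun_star w \<kappa> \<phi>b (Suc n) z + (- \<Omega>' n z + V z) * assoc_fun_star w \<kappa> \<phi>b n z"
        unfolding \<Theta>'(4)[OF z] by (simp add: left_diff_distrib distrib_right)
    qed (fact \<Theta> | rule holomorphic_on_minus, fact \<Theta>')+
  qed (fact V W_nonzero)+
qed

end
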